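(* Let $(E,[\![\cdot,\cdot]\!]_D,\rho,(\cdot,\cdot))$ be a Vaisman algebroid over a smooth manifold $M$. For $e_1,e_2\in\Gamma(E)$ and $f\in C^\infty(M)$ define, by formal exponentials, $$e_1\trianglerighteq e_2:=\exp(\mathrm{ad}(e_1))\,e_2,\qquad e_1\trianglerighteq f:=\exp(\rho(e_1))\,f,$$ where $\mathrm{ad}(e_1)e_2=[\![e_1,e_2]\!]_D$. Then $E$ with these operations is a (formal) metric pre-rackoid, i.e. the following identities hold (as identities of formal power series, in the sense explained in the context) for all $e_1,e_2,e_3\in\Gamma(E)$ and $f\in C^\infty(M)$: $$e_1\trianglerighteq(fe_2)=(e_1\trianglerighteq f)\cdot(e_1\trianglerighteq e_2),$$ $$e_1\trianglerighteq(e_2,e_3)=\big(e_1\trianglerighteq e_2,\;e_1\trianglerighteq e_3\big).$$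
   Context: A Vaisman algebroid over a smooth manifold $M$ is a quadruple $(E,[\![\cdot,\cdot]\!]_D,\rho,(\cdot,\cdot))$ where $E\to M$ is a smooth real vector bundle, $[\![\cdot,\cdot]\!]_D$ is an $\mathbb{R}$-bilinear bracket on $\Gamma(E)$ (the D-bracket), $\rho:E\to TM$ is a bundle map (the anchor), and $(\cdot,\cdot)$ is a non-degenerate symmetric bilinear form on $E$ (a pseudo-Euclidean inner product), such that for all $e_1,e_2,e_3\in\Gamma(E)$, $f\in C^\infty(M)$: (1) $[\![e_1,fe_2]\!]_D=f[\![e_1,e_2]\!]_D+(\rho(e_1)\cdot f)\,e_2$; (2) $\rho(e_1)\cdot(e_2,e_3)=([\![e_1,e_2]\!]_D,e_3)+(e_2,[\![e_1,e_3]\!]_D)$. No Leibniz identity is assumed. A metric (bundle) pre-rackoid is a vector bundle $E$ over $M$ with a pseudo-Euclidean inner product $(\cdot,\cdot)$ and operations $\trianglerighteq:\Gamma(E)\times\Gamma(E)\to\Gamma(E)$ and $\trianglerighteq:\Gamma(E)\times C^\infty(M)\to C^\infty(M)$ satisfying the two identities of the claim, where $\cdot$ is multiplication of sections by functions. Meaning of "formal": $\exp(A)=\sum_{n\ge0}\frac{1}{n!}A^n$ is a formal series and no convergence is claimed. Concretely, let $t$ be a formal parameter, extend the bracket, the anchor action, the inner product and the products $t$-linearly and continuously to $\Gamma(E)[[t]]$ and $C^\infty(M)[[t]]$, and replace the acting section $e_1$ by $te_1$; the identities read $\exp(\mathrm{ad}(te_1))(fe_2)=\big(\exp(\rho(te_1))f\big)\big(\exp(\mathrm{ad}(te_1))e_2\big)$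 in $\Gamma(E)[[t]]$ and $\exp(\rho(te_1))(e_2,e_3)=\big(\exp(\mathrm{ad}(te_1))e_2,\exp(\mathrm{ad}(te_1))e_3\big)$ in $C^\infty(M)[[t]]$. *)

theory Defs
  imports
    "HOL-Analysis.Analysis"
    "HOL-Computational_Algebra.Formal_Power_Series"
    "HOL-Library.Function_Algebras"
begin

section \<open>Smooth maps\<close>

text \<open>
  The model spaces of manifolds and fibres are finite-dimensional real inner product spaces.
  The class \<open>real_inner\<close> is used with an explicit finiteness assumption, since
  \<open>euclidean_space\<close> would exclude dimension (or rank) 0.
\<close>

definition finite_dim :: "'a::real_vector itself \<Rightarrow> bool" where
  "finite_dim _ \<longleftrightarrow> (\<exists>B::'a set. finite B \<and> span B = UNIV)"

text \<open>
  On an open subset of a finite-dimensional space, \<open>Ck_on k\<close> is the usual notion of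
  a \<open>k\<close> times continuously differentiable map: all directional derivatives of a
  differentiable map are \<open>k - 1\<close> times continuously differentiable.
\<close>

primrec Ck_on :: "nat \<Rightarrow> ('a::real_normed_vector \<Rightarrow> 'b::real_normed_vector) \<Rightarrow> 'a set \<Rightarrow> bool" where
  "Ck_on 0 = (\<lambda>f S. continuous_on S f)"
| "Ck_on (Suc k) = (\<lambda>f S. (\<forall>x\<in>S. f differentiable (at x)) \<and>
     (\<forall>v. Ck_on k (\<lambda>x. frechet_derivative f (at x) v) S))"

definition smooth_on :: "('a::real_normed_vector \<Rightarrow> 'b::real_normed_vector) \<Rightarrow> 'a set \<Rightarrow> bool" where
  "smooth_on f S \<longleftrightarrow> (\<forall>k. Ck_on k f S)"


section \<open>Smooth manifolds\<close>

text \<open>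
  The underlying space of \<open>M\<close> is the whole type \<open>'m\<close>.  A chart is a pair
  \<open>(W, \<phi>)\<close> of an open domain and a coordinate map, whose values outside \<open>W\<close> are irrelevant.
  The atlas need not be maximal.
\<close>

type_synonym ('m, 'a) chart = "'m set \<times> ('m \<Rightarrow> 'a)"

locale smooth_manifold =
  fixes atlas :: "('m::{t2_space,second_countable_topology}, 'a::real_inner) chart set"
  assumes finite_dimension: "finite_dim TYPE('a)"
    and chart_cover: "(\<Union>(W, \<phi>)\<in>atlas. W) = UNIV"
    and chart_homeomorphism: "(W, \<phi>) \<in> atlas \<Longrightarrow>
      open W \<and> open (\<phi> ` W) \<and> homeomorphism W (\<phi> ` W) \<phi> (inv_into W \<phi>)"
    and chart_compatible: "(W, \<phi>) \<in> atlas \<Longrightarrow> (W', \<phi>') \<in> atlas \<Longrightarrow>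
      smooth_on (\<lambda>x. \<phi>' (inv_into W \<phi> x)) (\<phi> ` (W \<inter> W'))"

definition smooth_functions ::
  "('m, 'a::real_normed_vector) chart set \<Rightarrow> ('m \<Rightarrow> real) set" where
  "smooth_functions atlas =
     {f. \<forall>(W, \<phi>)\<in>atlas. smooth_on (\<lambda>x. f (inv_into W \<phi> x)) (\<phi> ` W)}"

text \<open>
  Tangent vectors at \<open>p\<close> are the derivations at \<open>p\<close> of the algebra of smooth functions.
  The value on functions that are not smooth is normalised to 0, so that a derivation is
  determined by its action on smooth functions.
\<close>

definition tangent_space ::
  "('m, 'a::real_normed_vector) chart set \<Rightarrow> 'm \<Rightarrow> (('m \<Rightarrow> real) \<Rightarrow> real) set" where
  "tangent_space atlas p = {X.
     (\<forall>f\<in>smooth_functions atlas. \<forall>g\<in>smooth_functions atlas.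
        X (\<lambda>q. f q + g q) = X f + X g \<and>
        X (\<lambda>q. f q * g q) = X f * g p + f p * X g) \<and>
     (\<forall>f\<in>smooth_functions atlas. \<forall>c. X (\<lambda>q. c * f q) = c * X f) \<and>
     (\<forall>f. f \<notin> smooth_functions atlas \<longrightarrow> X f = 0)}"

text \<open>
  \<open>tangent_coords atlas (W, \<phi>) p X a\<close> says that \<open>a\<close> is the coordinate vector of \<open>X\<close> in the
  chart, i.e. that \<open>X\<close> is the sum of the \<open>a\<^sub>i \<partial>/\<partial>\<phi>\<^sub>i\<close> at \<open>p\<close>.
\<close>

definition tangent_coords ::
  "('m, 'a::real_normed_vector) chart set \<Rightarrow> ('m, 'a) chart \<Rightarrow> 'm \<Rightarrow>
     (('m \<Rightarrow> real) \<Rightarrow> real) \<Rightarrow> 'a \<Rightarrow> bool" where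
  "tangent_coords atlas = (\<lambda>(W, \<phi>) p X a. \<forall>f\<in>smooth_functions atlas.
     X f = frechet_derivative (\<lambda>x. f (inv_into W \<phi> x)) (at (\<phi> p)) a)"


section \<open>Vector bundles\<close>

text \<open>
  A vector bundle is given by its fibres \<open>fib p\<close>, which are subspaces of some ambient real vector
  space \<open>'v\<close>, and by a bundle atlas of local trivialisations \<open>(U, \<Psi>)\<close>, where for \<open>p \<in> U\<close>
  the map \<open>\<Psi> p\<close> is a linear isomorphism from \<open>fib p\<close> onto the typical fibre \<open>'f\<close>.
  The total space is the disjoint union of the fibres; its topology and smooth structure are
  the ones induced by the trivialisations.  The space \<open>'v\<close> only serves to give the fibres a
  common type; nothing relates the bundle topology to it.
\<close>

type_synonym ('m, 'v, 'f) triv = "'m set \<times> ('m \<Rightarrow> 'v \<Rightarrow> 'f)"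

definition linear_between ::
  "'v::real_vector set \<Rightarrow> ('v \<Rightarrow> 'w::real_vector) \<Rightarrow> bool" where
  "linear_between V L \<longleftrightarrow>
     (\<forall>v\<in>V. \<forall>w\<in>V. L (v + w) = L v + L w) \<and> (\<forall>v\<in>V. \<forall>c. L (c *\<^sub>R v) = c *\<^sub>R L v)"

locale vector_bundle = smooth_manifold atlas
  for atlas :: "('m::{t2_space,second_countable_topology}, 'a::real_inner) chart set" +
  fixes fib :: "'m \<Rightarrow> 'v::real_vector set"
    and trivs :: "('m, 'v, 'f::real_inner) triv set"
  assumes finite_rank: "finite_dim TYPE('f)"
    and fibre_subspace: "subspace (fib p)"
    and triv_cover: "(\<Union>(U, \<Psi>)\<in>trivs. U) = UNIV"
    and triv_open: "(U, \<Psi>) \<in> trivs \<Longrightarrow> open U"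
    and triv_linear: "(U, \<Psi>) \<in> trivs \<Longrightarrow> p \<in> U \<Longrightarrow> linear_between (fib p) (\<Psi> p)"
    and triv_bij: "(U, \<Psi>) \<in> trivs \<Longrightarrow> p \<in> U \<Longrightarrow> bij_betw (\<Psi> p) (fib p) UNIV"
    and triv_compatible:
      "(U, \<Psi>) \<in> trivs \<Longrightarrow> (U', \<Psi>') \<in> trivs \<Longrightarrow> (W, \<phi>) \<in> atlas \<Longrightarrow>
       smooth_on (\<lambda>(x, y). let p = inv_into W \<phi> x in \<Psi>' p (inv_into (fib p) (\<Psi> p) y))
         (\<phi> ` (U \<inter> U' \<inter> W) \<times> UNIV)"

definition smooth_sections ::
  "('m, 'a::real_normed_vector) chart set \<Rightarrow> ('m \<Rightarrow> 'v set) \<Rightarrow>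
     ('m, 'v, 'f::real_normed_vector) triv set \<Rightarrow> ('m \<Rightarrow> 'v) set" where
  "smooth_sections atlas fib trivs = {s. (\<forall>p. s p \<in> fib p) \<and>
     (\<forall>(U, \<Psi>)\<in>trivs. \<forall>(W, \<phi>)\<in>atlas.
        smooth_on (\<lambda>x. let p = inv_into W \<phi> x in \<Psi> p (s p)) (\<phi> ` (U \<inter> W)))}"

locale pseudo_euclidean_bundle = vector_bundle atlas fib trivs
  for atlas :: "('m::{t2_space,second_countable_topology}, 'a::real_inner) chart set"
    and fib :: "'m \<Rightarrow> 'v::real_vector set"
    and trivs :: "('m, 'v, 'f::real_inner) triv set" +
  fixes ip :: "'m \<Rightarrow> 'v \<Rightarrow> 'v \<Rightarrow> real"
  assumes ip_linear: "v \<in> fib p \<Longrightarrow> linear_between (fib p) (ip p v)"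
    and ip_sym: "v \<in> fib p \<Longrightarrow> w \<in> fib p \<Longrightarrow> ip p v w = ip p w v"
    and ip_nondegenerate: "v \<in> fib p \<Longrightarrow> (\<And>w. w \<in> fib p \<Longrightarrow> ip p v w = 0) \<Longrightarrow> v = 0"
    and ip_smooth: "(U, \<Psi>) \<in> trivs \<Longrightarrow> (W, \<phi>) \<in> atlas \<Longrightarrow>
      smooth_on (\<lambda>(x, y, z). let p = inv_into W \<phi> x in
          ip p (inv_into (fib p) (\<Psi> p) y) (inv_into (fib p) (\<Psi> p) z))
        (\<phi> ` (U \<inter> W) \<times> UNIV \<times> UNIV)"

text \<open>
  A bundle map \<open>\<rho>\<close> from the bundle to \<open>TM\<close> over the identity: fibrewise linear, and in each
  trivialisation and chart of the form \<open>(x, y) \<mapsto> (x, R (x, y))\<close> with \<open>R\<close> smooth.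
\<close>

definition bundle_map_to_tangent ::
  "('m, 'a::real_normed_vector) chart set \<Rightarrow> ('m \<Rightarrow> 'v::real_vector set) \<Rightarrow>
     ('m, 'v, 'f::real_normed_vector) triv set \<Rightarrow>
     ('m \<Rightarrow> 'v \<Rightarrow> ('m \<Rightarrow> real) \<Rightarrow> real) \<Rightarrow> bool" where
  "bundle_map_to_tangent atlas fib trivs \<rho> \<longleftrightarrow>
     (\<forall>p. \<forall>v\<in>fib p. \<rho> p v \<in> tangent_space atlas p) \<and>
     (\<forall>p f. linear_between (fib p) (\<lambda>v. \<rho> p v f)) \<and>
     (\<forall>(U, \<Psi>)\<in>trivs. \<forall>(W, \<phi>)\<in>atlas. \<exists>R. smooth_on R (\<phi> ` (U \<inter> W) \<times> UNIV) \<and>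
        (\<forall>p\<in>U \<inter> W. \<forall>y. tangent_coords atlas (W, \<phi>) p
           (\<rho> p (inv_into (fib p) (\<Psi> p) y)) (R (\<phi> p, y))))"


section \<open>Vaisman algebroids\<close>

definition fun_times_section :: "('m \<Rightarrow> real) \<Rightarrow> ('m \<Rightarrow> 'v::real_vector) \<Rightarrow> 'm \<Rightarrow> 'v" where
  "fun_times_section f s = (\<lambda>p. f p *\<^sub>R s p)"

definition section_inner ::
  "('m \<Rightarrow> 'v \<Rightarrow> 'v \<Rightarrow> real) \<Rightarrow> ('m \<Rightarrow> 'v) \<Rightarrow> ('m \<Rightarrow> 'v) \<Rightarrow> 'm \<Rightarrow> real" where
  "section_inner ip s t = (\<lambda>p. ip p (s p) (t p))"

definition anchor_action ::
  "('m \<Rightarrow> 'v \<Rightarrow> ('m \<Rightarrow> real) \<Rightarrow> real) \<Rightarrow> ('m \<Rightarrow> 'v) \<Rightarrow> ('m \<Rightarrow> real) \<Rightarrow> 'm \<Rightarrow> real" where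
  "anchor_action \<rho> e f = (\<lambda>p. \<rho> p (e p) f)"

definition section_scale :: "real \<Rightarrow> ('m \<Rightarrow> 'v::real_vector) \<Rightarrow> 'm \<Rightarrow> 'v" where
  "section_scale c s = (\<lambda>p. c *\<^sub>R s p)"

locale vaisman_algebroid = pseudo_euclidean_bundle atlas fib trivs ip
  for atlas :: "('m::{t2_space,second_countable_topology}, 'a::real_inner) chart set"
    and fib :: "'m \<Rightarrow> 'v::real_vector set"
    and trivs :: "('m, 'v, 'f::real_inner) triv set"
    and ip :: "'m \<Rightarrow> 'v \<Rightarrow> 'v \<Rightarrow> real" +
  fixes bracket :: "('m \<Rightarrow> 'v) \<Rightarrow> ('m \<Rightarrow> 'v) \<Rightarrow> 'm \<Rightarrow> 'v"
    and \<rho> :: "'m \<Rightarrow> 'v \<Rightarrow> ('m \<Rightarrow> real) \<Rightarrow> real"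
  assumes anchor_bundle_map: "bundle_map_to_tangent atlas fib trivs \<rho>"
    and bracket_closed: "\<lbrakk>e1 \<in> smooth_sections atlas fib trivs; e2 \<in> smooth_sections atlas fib trivs\<rbrakk>
      \<Longrightarrow> bracket e1 e2 \<in> smooth_sections atlas fib trivs"
    and bracket_add_left: "\<lbrakk>e1 \<in> smooth_sections atlas fib trivs;
      e1' \<in> smooth_sections atlas fib trivs; e2 \<in> smooth_sections atlas fib trivs\<rbrakk>
      \<Longrightarrow> bracket (e1 + e1') e2 = bracket e1 e2 + bracket e1' e2"
    and bracket_add_right: "\<lbrakk>e1 \<in> smooth_sections atlas fib trivs;
      e2 \<in> smooth_sections atlas fib trivs; e2' \<in> smooth_sections atlas fib trivs\<rbrakk>
      \<Longrightarrow> bracket e1 (e2 + e2') = bracket e1 e2 + bracket e1 e2'"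
    and bracket_scale_left: "\<lbrakk>e1 \<in> smooth_sections atlas fib trivs;
      e2 \<in> smooth_sections atlas fib trivs\<rbrakk>
      \<Longrightarrow> bracket (section_scale c e1) e2 = section_scale c (bracket e1 e2)"
    and bracket_scale_right: "\<lbrakk>e1 \<in> smooth_sections atlas fib trivs;
      e2 \<in> smooth_sections atlas fib trivs\<rbrakk>
      \<Longrightarrow> bracket e1 (section_scale c e2) = section_scale c (bracket e1 e2)"
    and bracket_anchor: "\<lbrakk>e1 \<in> smooth_sections atlas fib trivs;
      e2 \<in> smooth_sections atlas fib trivs; f \<in> smooth_functions atlas\<rbrakk>
      \<Longrightarrow> bracket e1 (fun_times_section f e2) =
          fun_times_section f (bracket e1 e2) + fun_times_section (anchor_action \<rho> e1 f) e2"
    and bracket_inner: "\<lbrakk>e1 \<in> smooth_sections atlas fib trivs;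
      e2 \<in> smooth_sections atlas fib trivs; e3 \<in> smooth_sections atlas fib trivs\<rbrakk>
      \<Longrightarrow> anchor_action \<rho> e1 (section_inner ip e2 e3) =
          section_inner ip (bracket e1 e2) e3 + section_inner ip e2 (bracket e1 e3)"


section \<open>Formal power series and formal exponentials\<close>

text \<open>The extension of an operation to power series that is bilinear and continuous in \<open>t\<close>.\<close>

definition fps_extend2 :: "('x \<Rightarrow> 'y \<Rightarrow> 'z::comm_monoid_add) \<Rightarrow> 'x fps \<Rightarrow> 'y fps \<Rightarrow> 'z fps" where
  "fps_extend2 \<beta> F G = Abs_fps (\<lambda>n. \<Sum>i\<le>n. \<beta> (fps_nth F i) (fps_nth G (n - i)))"

definition t_times :: "'x::zero \<Rightarrow> 'x fps" where
  "t_times x = Abs_fps (\<lambda>n. if n = 1 then x else 0)"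

definition fps_section_scale ::
  "real \<Rightarrow> ('m \<Rightarrow> 'v::real_vector) fps \<Rightarrow> ('m \<Rightarrow> 'v) fps" where
  "fps_section_scale c F = Abs_fps (\<lambda>n. section_scale c (fps_nth F n))"

text \<open>
  The infinite sum is taken in the \<open>t\<close>-adic topology of the type of formal power series.
  It converges whenever \<open>T\<close> raises the \<open>t\<close>-adic order, as \<open>ad(t e)\<close> and \<open>\<rho>(t e)\<close> do;
  see \<open>formal_exp_sums\<close>.
\<close>

definition formal_exp ::
  "(('m \<Rightarrow> 'v::real_vector) fps \<Rightarrow> ('m \<Rightarrow> 'v) fps) \<Rightarrow> ('m \<Rightarrow> 'v) fps \<Rightarrow> ('m \<Rightarrow> 'v) fps" where
  "formal_exp T F = (\<Sum>n. fps_section_scale (1 / fact n) ((T ^^ n) F))"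

lemma formal_exp_sums:
  fixes T :: "('m \<Rightarrow> 'v::real_vector) fps \<Rightarrow> ('m \<Rightarrow> 'v) fps"
  assumes order: "\<And>n i. i < n \<Longrightarrow> fps_nth ((T ^^ n) F) i = 0"
  shows "(\<lambda>n. fps_section_scale (1 / fact n) ((T ^^ n) F)) sums
      Abs_fps (\<lambda>N. \<Sum>n\<le>N. section_scale (1 / fact n) (fps_nth ((T ^^ n) F) N))"
proof -
  let ?a = "\<lambda>n N. section_scale (1 / fact n) (fps_nth ((T ^^ n) F) N) :: 'm \<Rightarrow> 'v"
  have nth: "fps_nth (\<Sum>n<k. fps_section_scale (1 / fact n) ((T ^^ n) F)) N = (\<Sum>n<k. ?a n N)" for k N
    by (simp add: fps_sum_nth fps_section_scale_def)
  have zero: "?a n N = 0" if "N < n" for n N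
    using order[OF that] by (simp add: section_scale_def fun_eq_iff)
  have "(\<Sum>n<k. ?a n N) = (\<Sum>n\<le>N. ?a n N)" if "N < k" for k N
    using that by (intro sum.mono_neutral_right) (auto intro: zero)
  then have "\<forall>\<^sub>F k in sequentially. (\<Sum>n<k. ?a n N) = (\<Sum>n\<le>N. ?a n N)" for N
    using eventually_gt_at_top[of N] by (rule eventually_mono[rotated])
  then show ?thesis
    unfolding sums_def by (intro tendsto_fpsI) (simp add: nth)
qed

definition exp_ad ::
  "(('m \<Rightarrow> 'v) \<Rightarrow> ('m \<Rightarrow> 'v) \<Rightarrow> 'm \<Rightarrow> 'v::real_vector) \<Rightarrow> ('m \<Rightarrow> 'v) \<Rightarrow> ('m \<Rightarrow> 'v) \<Rightarrow> ('m \<Rightarrow> 'v) fps" where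
  "exp_ad bracket e1 e2 = formal_exp (fps_extend2 bracket (t_times e1)) (fps_const e2)"

definition exp_anchor ::
  "('m \<Rightarrow> 'v::real_vector \<Rightarrow> ('m \<Rightarrow> real) \<Rightarrow> real) \<Rightarrow> ('m \<Rightarrow> 'v) \<Rightarrow> ('m \<Rightarrow> real) \<Rightarrow> ('m \<Rightarrow> real) fps" where
  "exp_anchor \<rho> e f = formal_exp (fps_extend2 (anchor_action \<rho>) (t_times e)) (fps_const f)"


section \<open>Formal metric pre-rackoids\<close>

text \<open>
  \<open>act_sec e\<^sub>1 e\<^sub>2\<close> and \<open>act_fun e\<^sub>1 f\<close> stand for the operations \<open>t e\<^sub>1 \<triangleright> e\<^sub>2\<close> and \<open>t e\<^sub>1 \<triangleright> f\<close>, with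
  values in the power series over the smooth sections and the smooth functions.  The left-hand
  sides of the two identities are evaluated on the section \<open>f e\<^sub>2\<close> and the function
  \<open>(e\<^sub>2, e\<^sub>3)\<close>; the products on the right-hand sides are those of power series.
\<close>

locale formal_metric_pre_rackoid = pseudo_euclidean_bundle atlas fib trivs ip
  for atlas :: "('m::{t2_space,second_countable_topology}, 'a::real_inner) chart set"
    and fib :: "'m \<Rightarrow> 'v::real_vector set"
    and trivs :: "('m, 'v, 'f::real_inner) triv set"
    and ip :: "'m \<Rightarrow> 'v \<Rightarrow> 'v \<Rightarrow> real" +
  fixes act_sec :: "('m \<Rightarrow> 'v) \<Rightarrow> ('m \<Rightarrow> 'v) \<Rightarrow> ('m \<Rightarrow> 'v) fps"
    and act_fun :: "('m \<Rightarrow> 'v) \<Rightarrow> ('m \<Rightarrow> real) \<Rightarrow> ('m \<Rightarrow> real) fps"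
  assumes act_sec_closed: "\<lbrakk>e1 \<in> smooth_sections atlas fib trivs; e2 \<in> smooth_sections atlas fib trivs\<rbrakk>
      \<Longrightarrow> fps_nth (act_sec e1 e2) n \<in> smooth_sections atlas fib trivs"
    and act_fun_closed: "\<lbrakk>e1 \<in> smooth_sections atlas fib trivs; f \<in> smooth_functions atlas\<rbrakk>
      \<Longrightarrow> fps_nth (act_fun e1 f) n \<in> smooth_functions atlas"
    and act_mult: "\<lbrakk>e1 \<in> smooth_sections atlas fib trivs;
      e2 \<in> smooth_sections atlas fib trivs; f \<in> smooth_functions atlas\<rbrakk>
      \<Longrightarrow> act_sec e1 (fun_times_section f e2) =
          fps_extend2 fun_times_section (act_fun e1 f) (act_sec e1 e2)"
    and act_inner: "\<lbrakk>e1 \<in> smooth_sections atlas fib trivs;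
      e2 \<in> smooth_sections atlas fib trivs; e3 \<in> smooth_sections atlas fib trivs\<rbrakk>
      \<Longrightarrow> act_fun e1 (section_inner ip e2 e3) =
          fps_extend2 (section_inner ip) (act_sec e1 e2) (act_sec e1 e3)"

end

theory Submission
  imports Defs
begin

text \<open>
  The coefficients of the exponential of a linear operator \<open>D\<close> at \<open>y\<close> are the divided powers
  \<open>D\<^sup>n y / n!\<close>.  Both axioms of a Vaisman algebroid say that operators obey a Leibniz rule for a
  bilinear pairing \<open>\<beta>\<close>, and iterating it gives
  \<open>D\<^sup>n (\<beta> x y) / n! = (\<Sum>i\<le>n. \<beta> (D\<^sup>i x / i!) (D\<^sup>n\<^sup>-\<^sup>i y / (n-i)!))\<close>,
  the \<open>n\<close>-th coefficient of the claimed identity; no Leibniz identity for the bracket enters.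
  The analytic content is that the anchor maps smooth functions to smooth functions and that inner
  products of smooth sections are smooth: tangent vectors are additive only on smooth functions,
  so the iteration needs every intermediate function to be smooth.
\<close>

section \<open>Calculus of smooth maps\<close>

lemma Ck_on_subset: "Ck_on k f S \<Longrightarrow> T \<subseteq> S \<Longrightarrow> Ck_on k f T"
  by (induction k arbitrary: f) (auto intro: continuous_on_subset)

text \<open>Only the base case has content: differentiability gives continuity. The lemma supplies
  the lower order needed for factors that the product and chain rules leave
  undifferentiated.\<close>

lemma Ck_on_SucD: "Ck_on (Suc k) f S \<Longrightarrow> Ck_on k f S"
proof (induction k arbitrary: f)
  case 0
  then show ?case
    by (auto intro!: continuous_at_imp_continuous_on differentiable_imp_continuous_within)
next
  case (Suc k)
  then show ?case by (metis Ck_on.simps(2))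
qed

lemma frechet_derivative_eqI: "(f has_derivative f') (at x) \<Longrightarrow> frechet_derivative f (at x) = f'"
  by (metis frechet_derivative_at)

text \<open>The derivative at a point of \<open>S\<close> sees only a neighbourhood, which openness
  places inside \<open>S\<close>; so \<open>f\<close> and \<open>g\<close> have the same derivatives
  there, to every order.\<close>

lemma Ck_on_cong_open:
  assumes "open S" "\<And>x. x \<in> S \<Longrightarrow> f x = g x" "Ck_on k f S"
  shows "Ck_on k g S"
  using assms(2,3)
proof (induction k arbitrary: f g)
  case 0
  then show ?case by (auto cong: continuous_on_cong)
next
  case (Suc k)
  have g: "(g has_derivative frechet_derivative f (at x)) (at x)" if "x \<in> S" for x
  proof (rule has_derivative_transform_within_open[OF _ \<open>open S\<close> that])
    show "(f has_derivative frechet_derivative f (at x)) (at x)"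
      using Suc.prems(2) that by (simp add: frechet_derivative_works)
  qed (fact Suc.prems(1))
  have "Ck_on k (\<lambda>x. frechet_derivative g (at x) v) S" for v
  proof (rule Suc.IH)
    show "frechet_derivative f (at x) v = frechet_derivative g (at x) v" if "x \<in> S" for x
      using frechet_derivative_eqI[OF g[OF that]] by metis
    show "Ck_on k (\<lambda>x. frechet_derivative f (at x) v) S"
      using Suc.prems(2) by simp
  qed
  moreover have "\<forall>x\<in>S. g differentiable (at x)" using g differentiableI by blast
  ultimately show ?case unfolding Ck_on.simps by blast
qed

text \<open>Derivatives are taken in the whole space, not relative to the set, so the
  differentiability clauses pass to unions pointwise and openness enters only through
  continuity.\<close>

lemma Ck_on_Un_open:
  assumes "\<And>S. S \<in> \<S> \<Longrightarrow> open S" "\<And>S. S \<in> \<S> \<Longrightarrow> Ck_on k f S"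
  shows "Ck_on k f (\<Union>\<S>)"
  using assms(2)
proof (induction k arbitrary: f)
  case 0
  then show ?case using continuous_on_open_Union assms(1) by auto
next
  case (Suc k)
  then show ?case by (metis Ck_on.simps(2) UnionE)
qed

text \<open>Uniqueness of the derivative identifies the chosen value
  \<open>frechet_derivative\<close> with an explicit formula \<open>f'\<close>, so that the usual
  differentiation rules can drive inductions on the order.\<close>

lemma Ck_on_SucI:
  assumes "open S" "\<And>x. x \<in> S \<Longrightarrow> (f has_derivative f' x) (at x)"
    and "\<And>v. Ck_on k (\<lambda>x. f' x v) S"
  shows "Ck_on (Suc k) f S"
proof -
  have eq: "f' x v = frechet_derivative f (at x) v" if "x \<in> S" for x v
    using frechet_derivative_eqI[OF assms(2)[OF that]] by metis
  have "Ck_on k (\<lambda>x. frechet_derivative f (at x) v) S" for v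
    by (rule Ck_on_cong_open[OF assms(1) eq assms(3)])
  moreover have "\<forall>x\<in>S. f differentiable (at x)" using assms(2) differentiableI by blast
  ultimately show ?thesis unfolding Ck_on.simps by blast
qed

lemma Ck_on_SucE:
  assumes "Ck_on (Suc k) f S"
  shows "\<And>x. x \<in> S \<Longrightarrow> (f has_derivative frechet_derivative f (at x)) (at x)"
    and "\<And>v. Ck_on k (\<lambda>x. frechet_derivative f (at x) v) S"
  using assms frechet_derivative_works by (simp_all, blast)

lemma Ck_on_const: "open S \<Longrightarrow> Ck_on k (\<lambda>x. c) S"
proof (induction k arbitrary: c)
  case (Suc k)
  show ?case by (rule Ck_on_SucI[where f' = "\<lambda>x v. 0"]) (use Suc in auto)
qed auto

lemma Ck_on_bounded_linear_compose:
  assumes "open S" "bounded_linear h" "Ck_on k f S"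
  shows "Ck_on k (\<lambda>x. h (f x)) S"
  using assms(3)
proof (induction k arbitrary: f)
  case 0
  then show ?case using bounded_linear.continuous_on[OF assms(2)] by auto
next
  case (Suc k)
  note f = Ck_on_SucE[OF Suc.prems]
  show ?case
    by (rule Ck_on_SucI[where f' = "\<lambda>x v. h (frechet_derivative f (at x) v)"])
      (use f Suc.IH assms in \<open>auto intro: bounded_linear.has_derivative\<close>)
qed

lemma Ck_on_bounded_linear:
  assumes "open S" "bounded_linear f"
  shows "Ck_on k f S"
proof (cases k)
  case 0
  then show ?thesis using bounded_linear.continuous_on[OF assms(2) continuous_on_id] by simp
next
  case (Suc j)
  show ?thesis unfolding Suc
    by (rule Ck_on_SucI[OF assms(1) bounded_linear_imp_has_derivative[OF assms(2)] Ck_on_const[OF assms(1)]])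
qed

lemma Ck_on_add:
  assumes "open S" "Ck_on k f S" "Ck_on k g S"
  shows "Ck_on k (\<lambda>x. f x + g x) S"
  using assms(2,3)
proof (induction k arbitrary: f g)
  case 0
  then show ?case by (auto intro: continuous_on_add)
next
  case (Suc k)
  note f = Ck_on_SucE[OF Suc.prems(1)] and g = Ck_on_SucE[OF Suc.prems(2)]
  show ?case
    by (rule Ck_on_SucI[OF assms(1) has_derivative_add[OF f(1) g(1)] Suc.IH[OF f(2) g(2)]])
qed

lemma Ck_on_sum:
  assumes "open S" "\<And>i. i \<in> I \<Longrightarrow> Ck_on k (f i) S"
  shows "Ck_on k (\<lambda>x. \<Sum>i\<in>I. f i x) S"
  using assms(2)
  by (induction I rule: infinite_finite_induct) (auto intro: Ck_on_const Ck_on_add assms(1))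

lemma Ck_on_bounded_bilinear:
  assumes "open S" "bounded_bilinear h" "Ck_on k f S" "Ck_on k g S"
  shows "Ck_on k (\<lambda>x. h (f x) (g x)) S"
  using assms(3,4)
proof (induction k arbitrary: f g)
  case 0
  then show ?case using bounded_bilinear.continuous_on[OF assms(2)] by auto
next
  case (Suc k)
  note f = Ck_on_SucE[OF Suc.prems(1)] and g = Ck_on_SucE[OF Suc.prems(2)]
  show ?case
  proof (rule Ck_on_SucI[where f' =
        "\<lambda>x v. h (f x) (frechet_derivative g (at x) v) + h (frechet_derivative f (at x) v) (g x)"])
    \<comment> \<open>Each summand of the product rule pairs one derivative with one
      undifferentiated factor, and the latter is lowered from order \<open>Suc k\<close> to
      \<open>k\<close>.\<close>
    show "Ck_on k (\<lambda>x. h (f x) (frechet_derivative g (at x) v)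
        + h (frechet_derivative f (at x) v) (g x)) S" for v
      by (intro Ck_on_add Suc.IH f(2) g(2) assms(1) Suc.prems[THEN Ck_on_SucD])
  qed (use f g assms in \<open>auto intro: bounded_bilinear.FDERIV\<close>)
qed

lemma Ck_on_Pair:
  assumes "open S" "Ck_on k f S" "Ck_on k g S"
  shows "Ck_on k (\<lambda>x. (f x, g x)) S"
  using assms(2,3)
proof (induction k arbitrary: f g)
  case 0
  then show ?case by (auto intro: continuous_on_Pair)
next
  case (Suc k)
  note f = Ck_on_SucE[OF Suc.prems(1)] and g = Ck_on_SucE[OF Suc.prems(2)]
  show ?case
    by (rule Ck_on_SucI[OF assms(1) has_derivative_Pair[OF f(1) g(1)] Suc.IH[OF f(2) g(2)]])
qed

section \<open>Orthogonal expansions in finite dimension and the chain rule\<close>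

lemma finite_dim_orthogonal_expansion:
  assumes "finite_dim TYPE('b::real_inner)"
  obtains B :: "'b::real_inner set" where "finite B" "\<And>x. x = (\<Sum>b\<in>B. (x \<bullet> b / (b \<bullet> b)) *\<^sub>R b)"
proof -
  obtain A :: "'b set" where "finite A" "span A = UNIV"
    using assms by (auto simp: finite_dim_def)
  \<comment> \<open>Gram-Schmidt. \<open>B\<close> may contain the zero vector, whose term in the
    expansion vanishes whatever value the quotient has.\<close>
  then obtain B :: "'b set" where B: "finite B" "span B = UNIV" "pairwise orthogonal B"
    using basis_orthogonal[of A] by auto
  have "x = (\<Sum>b\<in>B. (x \<bullet> b / (b \<bullet> b)) *\<^sub>R b)" for x
  proof -
    let ?y = "x - (\<Sum>b\<in>B. (x \<bullet> b / (b \<bullet> b)) *\<^sub>R b)"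
    have "orthogonal ?y c" if "c \<in> B" for c
    proof -
      have "(\<Sum>b\<in>B. (x \<bullet> b / (b \<bullet> b)) *\<^sub>R b) \<bullet> c = (\<Sum>b\<in>B. if b = c then x \<bullet> c else 0)"
        unfolding inner_sum_left using B(3) that
        by (intro sum.cong) (auto simp: pairwise_def orthogonal_def)
      then show ?thesis using B(1) that by (simp add: orthogonal_def inner_diff_left)
    qed
    \<comment> \<open>The remainder is orthogonal to a spanning set, hence to itself.\<close>
    then have "orthogonal ?y ?y" using orthogonal_to_span[of ?y B ?y] B(2) by auto
    then show ?thesis by (simp add: orthogonal_def)
  qed
  then show ?thesis using B(1) that by blast
qed

text \<open>The chain rule asks for a finite-dimensional intermediate space; the local expressions
  of anchor and inner product are composed through products of the chart model and the typical
  fibre.\<close>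

lemma finite_dim_prod:
  assumes "finite_dim TYPE('a::real_vector)" "finite_dim TYPE('b::real_vector)"
  shows "finite_dim TYPE('a::real_vector \<times> 'b::real_vector)"
proof -
  obtain A :: "'a set" and B :: "'b set"
    where A: "finite A" "span A = UNIV" and B: "finite B" "span B = UNIV"
    using assms by (auto simp: finite_dim_def)
  have l: "linear (\<lambda>x::'a. (x, 0::'b))" "linear (\<lambda>y::'b. (0::'a, y))"
    by (auto intro!: linearI)
  let ?C = "(\<lambda>x. (x, 0)) ` A \<union> (\<lambda>y. (0, y)) ` B :: ('a \<times> 'b) set"
  have "(x, y) \<in> span ?C" for x y
  proof -
    have "(x, 0) \<in> span ((\<lambda>x. (x, 0::'b)) ` A)" "(0, y) \<in> span ((\<lambda>y. (0::'a, y)) ` B)"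
      using A B by (auto simp: span_linear_image l)
    then have "(x, 0) \<in> span ?C" "(0, y) \<in> span ?C"
      by (meson span_mono Un_upper1 Un_upper2 subsetD)+
    then have "(x, 0) + (0, y) \<in> span ?C" by (rule span_add)
    then show ?thesis by simp
  qed
  then have "span ?C = UNIV" by auto
  then show ?thesis using A B unfolding finite_dim_def by (meson finite_UnI finite_imageI)
qed

text \<open>
  The expansion of \<open>a x\<close> in a basis reduces evaluation at the variable vector \<open>a x\<close> to the fixed
  directions to which \<open>Ck_on\<close> refers.
\<close>

lemma Ck_on_linear_family:
  fixes a :: "'a::real_normed_vector \<Rightarrow> 'b::real_inner" and L :: "'a \<Rightarrow> 'b \<Rightarrow> 'c::real_normed_vector"
  assumes "finite_dim TYPE('b)" "open S" "Ck_on k a S"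
    and L: "\<And>x. x \<in> S \<Longrightarrow> linear (L x)" "\<And>v. Ck_on k (\<lambda>x. L x v) S"
  shows "Ck_on k (\<lambda>x. L x (a x)) S"
proof -
  obtain B :: "'b set" where B: "\<And>y. y = (\<Sum>b\<in>B. (y \<bullet> b / (b \<bullet> b)) *\<^sub>R b)"
    using finite_dim_orthogonal_expansion[OF assms(1)] by metis
  have eq: "(\<Sum>b\<in>B. (a x \<bullet> b / (b \<bullet> b)) *\<^sub>R L x b) = L x (a x)" if "x \<in> S" for x
  proof -
    interpret linear "L x" using L(1) that .
    show ?thesis by (subst (2) B) (simp add: sum scaleR)
  qed
  have coef: "bounded_linear (\<lambda>y::'b. y \<bullet> b / (b \<bullet> b))" for b
    by (intro bounded_linear_divide[THEN bounded_linear_compose] bounded_linear_inner_left)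
  show ?thesis
    by (rule Ck_on_cong_open[OF assms(2) eq], assumption)
      (intro Ck_on_sum Ck_on_bounded_bilinear[OF _ bounded_bilinear_scaleR] assms
        Ck_on_bounded_linear_compose[OF _ coef])
qed

text \<open>Induction on the order with \<open>f\<close> fixed and \<open>g\<close> arbitrary. The
  derivative of the composite evaluates a linear map at a direction that varies with
  \<open>x\<close>; \<open>Ck_on_linear_family\<close> reduces this to fixed directions
  \<open>w\<close>, where the induction hypothesis applies to the derivative of \<open>g\<close>
  along \<open>w\<close>.\<close>

lemma Ck_on_compose:
  fixes f :: "'a::real_normed_vector \<Rightarrow> 'b::real_inner" and g :: "'b \<Rightarrow> 'c::real_normed_vector"
  assumes "finite_dim TYPE('b)" "open S" "f ` S \<subseteq> T" "Ck_on k f S" "Ck_on k g T"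
  shows "Ck_on k (\<lambda>x. g (f x)) S"
  using assms(4,5)
proof (induction k arbitrary: g)
  case 0
  then show ?case using assms(3) by (auto intro: continuous_on_compose2)
next
  case (Suc k)
  note f = Ck_on_SucE[OF Suc.prems(1)] and g = Ck_on_SucE[OF Suc.prems(2)]
  have gx: "(g has_derivative frechet_derivative g (at (f x))) (at (f x))" if "x \<in> S" for x
    using that assms(3) g(1) by auto
  show ?case
  proof (rule Ck_on_SucI[where f' =
        "\<lambda>x v. frechet_derivative g (at (f x)) (frechet_derivative f (at x) v)"])
    show "Ck_on k (\<lambda>x. frechet_derivative g (at (f x)) (frechet_derivative f (at x) v)) S" for v
    proof (rule Ck_on_linear_family[OF assms(1,2) f(2)])
      show "linear (frechet_derivative g (at (f x)))" if "x \<in> S" for x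
        using gx[OF that] by (rule has_derivative_linear)
      show "Ck_on k (\<lambda>x. frechet_derivative g (at (f x)) w) S" for w
        by (rule Suc.IH[OF Ck_on_SucD[OF Suc.prems(1)] g(2)])
    qed
    show "((\<lambda>x. g (f x)) has_derivative
        (\<lambda>v. frechet_derivative g (at (f x)) (frechet_derivative f (at x) v))) (at x)" if "x \<in> S" for x
      by (rule has_derivative_compose[OF f(1)[OF that] gx[OF that]])
  qed (fact assms)
qed

section \<open>From finite order to smooth maps\<close>

lemma smooth_on_subset: "smooth_on f S \<Longrightarrow> T \<subseteq> S \<Longrightarrow> smooth_on f T"
  unfolding smooth_on_def by (blast intro: Ck_on_subset)

lemma smooth_on_cong_open:
  "open S \<Longrightarrow> (\<And>x. x \<in> S \<Longrightarrow> f x = g x) \<Longrightarrow> smooth_on f S \<Longrightarrow> smooth_on g S"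
  unfolding smooth_on_def by (blast intro: Ck_on_cong_open)

lemma smooth_on_Union_open:
  "(\<And>S. S \<in> \<S> \<Longrightarrow> open S) \<Longrightarrow> (\<And>S. S \<in> \<S> \<Longrightarrow> smooth_on f S) \<Longrightarrow> smooth_on f (\<Union>\<S>)"
  unfolding smooth_on_def by (blast intro: Ck_on_Un_open)

lemma smooth_on_const: "open S \<Longrightarrow> smooth_on (\<lambda>x. c) S"
  unfolding smooth_on_def by (blast intro: Ck_on_const)

lemma smooth_on_id: "open S \<Longrightarrow> smooth_on (\<lambda>x. x) S"
  unfolding smooth_on_def by (blast intro: Ck_on_bounded_linear bounded_linear_ident)

lemma smooth_on_add:
  "open S \<Longrightarrow> smooth_on f S \<Longrightarrow> smooth_on g S \<Longrightarrow> smooth_on (\<lambda>x. f x + g x) S"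
  unfolding smooth_on_def by (blast intro: Ck_on_add)

lemma smooth_on_scaleR:
  "open S \<Longrightarrow> smooth_on f S \<Longrightarrow> smooth_on g S \<Longrightarrow> smooth_on (\<lambda>x. f x *\<^sub>R g x) S"
  unfolding smooth_on_def by (blast intro: Ck_on_bounded_bilinear bounded_bilinear_scaleR)

lemma smooth_on_Pair:
  "open S \<Longrightarrow> smooth_on f S \<Longrightarrow> smooth_on g S \<Longrightarrow> smooth_on (\<lambda>x. (f x, g x)) S"
  unfolding smooth_on_def by (blast intro: Ck_on_Pair)

lemma smooth_on_compose:
  fixes f :: "'a::real_normed_vector \<Rightarrow> 'b::real_inner"
  assumes "finite_dim TYPE('b)" "open S" "f ` S \<subseteq> T" "smooth_on f S" "smooth_on g T"
  shows "smooth_on (\<lambda>x. g (f x)) S"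
  using assms unfolding smooth_on_def by (blast intro: Ck_on_compose)

lemma smooth_on_frechet_derivative:
  fixes f :: "'a::real_inner \<Rightarrow> 'b::real_normed_vector"
  assumes "finite_dim TYPE('a)" "open S" "smooth_on f S" "smooth_on a S"
  shows "smooth_on (\<lambda>x. frechet_derivative f (at x) (a x)) S"
  unfolding smooth_on_def
proof
  fix k
  \<comment> \<open>Differentiation costs one order, so \<open>f\<close> is taken one order higher
    than the direction field \<open>a\<close>.\<close>
  have f: "Ck_on (Suc k) f S" and a: "Ck_on k a S" using assms unfolding smooth_on_def by blast+
  show "Ck_on k (\<lambda>x. frechet_derivative f (at x) (a x)) S"
    by (rule Ck_on_linear_family[OF assms(1,2) a has_derivative_linear[OF Ck_on_SucE(1)[OF f]]
          Ck_on_SucE(2)[OF f]])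
qed

section \<open>Smooth functions and sections\<close>

context smooth_manifold
begin

lemma chart_inverse: "(W, \<phi>) \<in> atlas \<Longrightarrow> p \<in> W \<Longrightarrow> inv_into W \<phi> (\<phi> p) = p"
  using chart_homeomorphism unfolding homeomorphism_def by blast

text \<open>A homeomorphism onto \<open>\<phi>\<close>
  W\<open>sends open sets to relatively open ones, and\<close>\<phi> \<open>W\<close> is itself
  open. This provides the open domains on which the calculus rules work.\<close>

lemma open_chart_image:
  assumes "(W, \<phi>) \<in> atlas" "open U"
  shows "open (\<phi> ` (U \<inter> W))"
proof -
  have "openin (top_of_set (\<phi> ` W)) (\<phi> ` (W \<inter> U))"
    using chart_homeomorphism[OF assms(1)] openin_open_Int[OF assms(2)]
    by (blast intro: homeomorphism_imp_open_map)
  then show ?thesis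
    using chart_homeomorphism[OF assms(1)] by (simp add: openin_open_eq Int_commute)
qed

lemma open_chart_range: "(W, \<phi>) \<in> atlas \<Longrightarrow> open (\<phi> ` W)"
  using chart_homeomorphism by blast

lemma smooth_functionsD:
  "f \<in> smooth_functions atlas \<Longrightarrow> (W, \<phi>) \<in> atlas \<Longrightarrow> smooth_on (\<lambda>x. f (inv_into W \<phi> x)) (\<phi> ` W)"
  unfolding smooth_functions_def by blast

lemma smooth_functions_const: "(\<lambda>p. c) \<in> smooth_functions atlas"
  unfolding smooth_functions_def by (auto intro: smooth_on_const open_chart_range)

lemma smooth_functions_add:
  assumes "f \<in> smooth_functions atlas" "g \<in> smooth_functions atlas"
  shows "f + g \<in> smooth_functions atlas"
  using smooth_functionsD[OF assms(1)] smooth_functionsD[OF assms(2)]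
  unfolding smooth_functions_def by (auto intro: smooth_on_add open_chart_range)

lemma smooth_functions_scale:
  assumes "f \<in> smooth_functions atlas"
  shows "section_scale c f \<in> smooth_functions atlas"
proof -
  have "smooth_on (\<lambda>x. c *\<^sub>R f (inv_into W \<phi> x)) (\<phi> ` W)" if "(W, \<phi>) \<in> atlas" for W \<phi>
    using that by (intro smooth_on_scaleR smooth_on_const open_chart_range smooth_functionsD[OF assms])
  then show ?thesis unfolding smooth_functions_def section_scale_def by blast
qed

end

context vector_bundle
begin

lemma triv_inverse:
  "(U, \<Psi>) \<in> trivs \<Longrightarrow> p \<in> U \<Longrightarrow> v \<in> fib p \<Longrightarrow> inv_into (fib p) (\<Psi> p) (\<Psi> p v) = v"
  using bij_betw_inv_into_left triv_bij by fast

lemma smooth_sections_fibre: "s \<in> smooth_sections atlas fib trivs \<Longrightarrow> s p \<in> fib p"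
  unfolding smooth_sections_def by blast

lemma smooth_sectionsD:
  "s \<in> smooth_sections atlas fib trivs \<Longrightarrow> (U, \<Psi>) \<in> trivs \<Longrightarrow> (W, \<phi>) \<in> atlas \<Longrightarrow>
    smooth_on (\<lambda>x. \<Psi> (inv_into W \<phi> x) (s (inv_into W \<phi> x))) (\<phi> ` (U \<inter> W))"
  unfolding smooth_sections_def Let_def by blast

text \<open>Since the chart image is open, a smooth coordinate expression with the right values at
  the points \<open>\<phi> p\<close> may replace the one in the definition. Checks can thus be made
  at points \<open>p\<close> of the manifold.\<close>

lemma smooth_sectionsI:
  assumes "\<And>p. s p \<in> fib p"
    and "\<And>U \<Psi> W \<phi>. (U, \<Psi>) \<in> trivs \<Longrightarrow> (W, \<phi>) \<in> atlas \<Longrightarrow> \<exists>h. smooth_on h (\<phi> ` (U \<inter> W)) \<and>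
      (\<forall>p\<in>U \<inter> W. h (\<phi> p) = \<Psi> p (s p))"
  shows "s \<in> smooth_sections atlas fib trivs"
proof -
  have "smooth_on (\<lambda>x. \<Psi> (inv_into W \<phi> x) (s (inv_into W \<phi> x))) (\<phi> ` (U \<inter> W))"
    if t: "(U, \<Psi>) \<in> trivs" and c: "(W, \<phi>) \<in> atlas" for U \<Psi> W \<phi>
  proof -
    obtain h where h: "smooth_on h (\<phi> ` (U \<inter> W))" "\<forall>p\<in>U \<inter> W. h (\<phi> p) = \<Psi> p (s p)"
      using assms(2)[OF t c] by blast
    show ?thesis
    proof (rule smooth_on_cong_open[OF open_chart_image[OF c triv_open[OF t]] _ h(1)])
      show "h x = \<Psi> (inv_into W \<phi> x) (s (inv_into W \<phi> x))" if "x \<in> \<phi> ` (U \<inter> W)" for x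
        using that h(2) chart_inverse[OF c] by auto
    qed
  qed
  then show ?thesis using assms(1) unfolding smooth_sections_def Let_def by blast
qed

lemma smooth_sections_add:
  assumes s: "s \<in> smooth_sections atlas fib trivs" and t: "t \<in> smooth_sections atlas fib trivs"
  shows "s + t \<in> smooth_sections atlas fib trivs"
proof (rule smooth_sectionsI)
  show "(s + t) p \<in> fib p" for p
    using smooth_sections_fibre[OF s] smooth_sections_fibre[OF t] subspace_add[OF fibre_subspace]
    by simp
next
  fix U \<Psi> W \<phi> assume T: "(U, \<Psi>) \<in> trivs" and C: "(W, \<phi>) \<in> atlas"
  let ?h = "\<lambda>x. \<Psi> (inv_into W \<phi> x) (s (inv_into W \<phi> x)) + \<Psi> (inv_into W \<phi> x) (t (inv_into W \<phi> x))"
  have "smooth_on ?h (\<phi> ` (U \<inter> W))"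
    by (intro smooth_on_add open_chart_image smooth_sectionsD triv_open[OF T] s t T C)
  moreover have "?h (\<phi> p) = \<Psi> p ((s + t) p)" if "p \<in> U \<inter> W" for p
    using that triv_linear[OF T, of p] chart_inverse[OF C, of p] smooth_sections_fibre[OF s, of p]
      smooth_sections_fibre[OF t, of p] by (simp add: linear_between_def)
  ultimately show "\<exists>h. smooth_on h (\<phi> ` (U \<inter> W)) \<and> (\<forall>p\<in>U \<inter> W. h (\<phi> p) = \<Psi> p ((s + t) p))"
    by blast
qed

lemma smooth_sections_fun_times:
  assumes f: "f \<in> smooth_functions atlas" and s: "s \<in> smooth_sections atlas fib trivs"
  shows "fun_times_section f s \<in> smooth_sections atlas fib trivs"
proof (rule smooth_sectionsI)
  show "fun_times_section f s p \<in> fib p" for p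
    using smooth_sections_fibre[OF s] subspace_scale[OF fibre_subspace]
    by (simp add: fun_times_section_def)
next
  fix U \<Psi> W \<phi> assume T: "(U, \<Psi>) \<in> trivs" and C: "(W, \<phi>) \<in> atlas"
  let ?h = "\<lambda>x. f (inv_into W \<phi> x) *\<^sub>R \<Psi> (inv_into W \<phi> x) (s (inv_into W \<phi> x))"
  have "smooth_on ?h (\<phi> ` (U \<inter> W))"
    by (intro smooth_on_scaleR open_chart_image smooth_sectionsD triv_open[OF T] s T C
        smooth_on_subset[OF smooth_functionsD[OF f C]] image_mono Int_lower2)
  moreover have "?h (\<phi> p) = \<Psi> p (fun_times_section f s p)" if "p \<in> U \<inter> W" for p
    using that triv_linear[OF T, of p] chart_inverse[OF C, of p] smooth_sections_fibre[OF s, of p]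
    by (simp add: linear_between_def fun_times_section_def)
  ultimately show "\<exists>h. smooth_on h (\<phi> ` (U \<inter> W)) \<and> (\<forall>p\<in>U \<inter> W. h (\<phi> p) = \<Psi> p (fun_times_section f s p))"
    by blast
qed

lemma smooth_sections_scale:
  assumes "s \<in> smooth_sections atlas fib trivs"
  shows "section_scale c s \<in> smooth_sections atlas fib trivs"
  using smooth_sections_fun_times[OF smooth_functions_const assms]
  by (simp add: fun_times_section_def section_scale_def)

text \<open>Smooth functions are tested on whole chart images, while bundle data have local
  expressions only over \<open>U \<inter> W\<close>. The trivialisation domains cover the manifold,
  so the open images of these overlaps cover the chart image and smoothness glues.\<close>

lemma smooth_functionsI_local:
  assumes "\<And>U \<Psi> W \<phi>. (U, \<Psi>) \<in> trivs \<Longrightarrow> (W, \<phi>) \<in> atlas \<Longrightarrow> \<exists>h. smooth_on h (\<phi> ` (U \<inter> W)) \<and>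
      (\<forall>p\<in>U \<inter> W. h (\<phi> p) = f p)"
  shows "f \<in> smooth_functions atlas"
proof -
  have "smooth_on (\<lambda>x. f (inv_into W \<phi> x)) (\<phi> ` W)" if C: "(W, \<phi>) \<in> atlas" for W \<phi>
  proof -
    let ?\<S> = "(\<lambda>(U, \<Psi>). \<phi> ` (U \<inter> W)) ` trivs"
    have "smooth_on (\<lambda>x. f (inv_into W \<phi> x)) (\<phi> ` (U \<inter> W))" if T: "(U, \<Psi>) \<in> trivs" for U \<Psi>
    proof -
      obtain h where h: "smooth_on h (\<phi> ` (U \<inter> W))" "\<forall>p\<in>U \<inter> W. h (\<phi> p) = f p"
        using assms[OF T C] by blast
      show ?thesis
      proof (rule smooth_on_cong_open[OF open_chart_image[OF C triv_open[OF T]] _ h(1)])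
        show "h x = f (inv_into W \<phi> x)" if "x \<in> \<phi> ` (U \<inter> W)" for x
          using that h(2) chart_inverse[OF C] by auto
      qed
    qed
    then have "smooth_on (\<lambda>x. f (inv_into W \<phi> x)) (\<Union>?\<S>)"
      using open_chart_image[OF C] triv_open by (intro smooth_on_Union_open) auto
    moreover have "\<Union>?\<S> = \<phi> ` W" using triv_cover by fastforce
    ultimately show ?thesis by simp
  qed
  then show ?thesis unfolding smooth_functions_def by blast
qed

text \<open>In coordinates this is the derivative of the expression of \<open>f\<close> in the
  direction \<open>R (x, ?s x)\<close>, which is smooth in \<open>x\<close> by the chain
  rule.\<close>

lemma anchor_action_smooth:
  assumes \<rho>: "bundle_map_to_tangent atlas fib trivs \<rho>"
    and e: "e \<in> smooth_sections atlas fib trivs" and f: "f \<in> smooth_functions atlas"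
  shows "anchor_action \<rho> e f \<in> smooth_functions atlas"
proof (rule smooth_functionsI_local)
  fix U \<Psi> W \<phi> assume T: "(U, \<Psi>) \<in> trivs" and C: "(W, \<phi>) \<in> atlas"
  obtain R where R: "smooth_on R (\<phi> ` (U \<inter> W) \<times> UNIV)"
    and coords: "\<And>p y. p \<in> U \<inter> W \<Longrightarrow> tangent_coords atlas (W, \<phi>) p
           (\<rho> p (inv_into (fib p) (\<Psi> p) y)) (R (\<phi> p, y))"
    using \<rho> T C unfolding bundle_map_to_tangent_def by fast
  let ?s = "\<lambda>x. \<Psi> (inv_into W \<phi> x) (e (inv_into W \<phi> x))"
  let ?h = "\<lambda>x. frechet_derivative (\<lambda>x. f (inv_into W \<phi> x)) (at x) (R (x, ?s x))"
  note S = open_chart_image[OF C triv_open[OF T]]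
  have "smooth_on (\<lambda>x. R (x, ?s x)) (\<phi> ` (U \<inter> W))"
    by (rule smooth_on_compose[OF finite_dim_prod[OF finite_dimension finite_rank] S _
          smooth_on_Pair[OF S smooth_on_id[OF S] smooth_sectionsD[OF e T C]] R]) auto
  then have "smooth_on ?h (\<phi> ` (U \<inter> W))"
    by (intro smooth_on_frechet_derivative[OF finite_dimension S]
        smooth_on_subset[OF smooth_functionsD[OF f C]] image_mono Int_lower2)
  moreover have "?h (\<phi> p) = anchor_action \<rho> e f p" if p: "p \<in> U \<inter> W" for p
    using coords[OF p, of "\<Psi> p (e p)"] f p triv_inverse[OF T, of p "e p"]
      smooth_sections_fibre[OF e, of p] chart_inverse[OF C, of p]
    by (simp add: tangent_coords_def anchor_action_def)
  ultimately show "\<exists>h. smooth_on h (\<phi> ` (U \<inter> W)) \<and> (\<forall>p\<in>U \<inter> W. h (\<phi> p) = anchor_action \<rho> e f p)"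
    by blast
qed

end

text \<open>The local expression of the metric is composed with \<open>x\<close> paired with the
  local expressions of both sections.\<close>

lemma (in pseudo_euclidean_bundle) section_inner_smooth:
  assumes s: "s \<in> smooth_sections atlas fib trivs" and t: "t \<in> smooth_sections atlas fib trivs"
  shows "section_inner ip s t \<in> smooth_functions atlas"
proof (rule smooth_functionsI_local)
  fix U \<Psi> W \<phi> assume T: "(U, \<Psi>) \<in> trivs" and C: "(W, \<phi>) \<in> atlas"
  let ?G = "\<lambda>(x, y, z). let p = inv_into W \<phi> x in
          ip p (inv_into (fib p) (\<Psi> p) y) (inv_into (fib p) (\<Psi> p) z)"
  let ?h = "\<lambda>x. ?G (x, \<Psi> (inv_into W \<phi> x) (s (inv_into W \<phi> x)), \<Psi> (inv_into W \<phi> x) (t (inv_into W \<phi> x)))"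
  note S = open_chart_image[OF C triv_open[OF T]]
  note dim = finite_dim_prod[OF finite_dimension finite_dim_prod[OF finite_rank finite_rank]]
  have "smooth_on ?h (\<phi> ` (U \<inter> W))"
    by (rule smooth_on_compose[OF dim S _ smooth_on_Pair[OF S smooth_on_id[OF S]
          smooth_on_Pair[OF S smooth_sectionsD[OF s T C] smooth_sectionsD[OF t T C]]]
          ip_smooth[OF T C]]) auto
  moreover have "?h (\<phi> p) = section_inner ip s t p" if p: "p \<in> U \<inter> W" for p
    using p triv_inverse[OF T, of p "s p"] triv_inverse[OF T, of p "t p"] chart_inverse[OF C, of p]
      smooth_sections_fibre[OF s, of p] smooth_sections_fibre[OF t, of p]
    by (simp add: section_inner_def Let_def)
  ultimately show "\<exists>h. smooth_on h (\<phi> ` (U \<inter> W)) \<and> (\<forall>p\<in>U \<inter> W. h (\<phi> p) = section_inner ip s t p)"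
    by blast
qed

section \<open>Exponentials and the Leibniz rule\<close>

text \<open>One interpretation serves sections and, with values in the reals, functions; it supplies
  distributivity over sums.\<close>

interpretation section_scale: vector_space section_scale
  by unfold_locales (auto simp: section_scale_def algebra_simps fun_eq_iff)

lemma fun_times_section_scale_left:
  "fun_times_section (section_scale c f) s = section_scale c (fun_times_section f s)"
  by (simp add: fun_times_section_def section_scale_def)

lemma fun_times_section_scale_right:
  "fun_times_section f (section_scale c s) = section_scale c (fun_times_section f s)"
  by (simp add: fun_times_section_def section_scale_def mult.commute)

text \<open>A linear endomorphism of \<open>Y\<close>, with linearity claimed only there: the
  bracket is controlled only on smooth sections and derivations only on smooth functions. Both
  actions become instances.\<close>

locale section_operator =
  fixes Y :: "('m \<Rightarrow> 'v::real_vector) set" and D :: "('m \<Rightarrow> 'v) \<Rightarrow> 'm \<Rightarrow> 'v"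
  assumes add_closed: "y \<in> Y \<Longrightarrow> z \<in> Y \<Longrightarrow> y + z \<in> Y"
    and scale_closed: "y \<in> Y \<Longrightarrow> section_scale c y \<in> Y"
    and closed: "y \<in> Y \<Longrightarrow> D y \<in> Y"
    and add: "y \<in> Y \<Longrightarrow> z \<in> Y \<Longrightarrow> D (y + z) = D y + D z"
    and scale: "y \<in> Y \<Longrightarrow> D (section_scale c y) = section_scale c (D y)"
begin

definition exp_coeff :: "nat \<Rightarrow> ('m \<Rightarrow> 'v) \<Rightarrow> 'm \<Rightarrow> 'v" where
  "exp_coeff n y = section_scale (1 / fact n) ((D ^^ n) y)"

lemma funpow_closed: "y \<in> Y \<Longrightarrow> (D ^^ n) y \<in> Y"
  by (induction n) (auto intro: closed)

lemma exp_coeff_closed: "y \<in> Y \<Longrightarrow> exp_coeff n y \<in> Y"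
  unfolding exp_coeff_def by (intro scale_closed funpow_closed)

lemma exp_coeff_0: "exp_coeff 0 y = y"
  by (simp add: exp_coeff_def)

text \<open>Divided powers replace the binomial coefficients of the iterated Leibniz rule by the
  single integer factor \<open>Suc n\<close>.\<close>

lemma operator_exp_coeff:
  "y \<in> Y \<Longrightarrow> D (exp_coeff n y) = section_scale (real (Suc n)) (exp_coeff (Suc n) y)"
  by (simp add: exp_coeff_def scale funpow_closed del: of_nat_Suc)

lemma exp_coeff_Suc:
  "y \<in> Y \<Longrightarrow> exp_coeff (Suc n) y = section_scale (1 / real (Suc n)) (D (exp_coeff n y))"
  by (simp add: operator_exp_coeff del: of_nat_Suc)

lemma sum_atMost_closed: "(\<And>i. g i \<in> Y) \<Longrightarrow> (\<Sum>i\<le>n. g i) \<in> Y" for n :: nat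
  by (induction n) (auto intro: add_closed)

lemma operator_sum_atMost: "(\<And>i. g i \<in> Y) \<Longrightarrow> D (\<Sum>i\<le>n. g i) = (\<Sum>i\<le>n. D (g i))" for n :: nat
  by (induction n) (auto simp: add sum_atMost_closed)

lemma operator_zero:
  assumes "y \<in> Y"
  shows "D 0 = 0"
  using scale[OF assms, of 0] by simp

text \<open>The extended operator is \<open>D\<close> followed by multiplication by the formal
  parameter, so its \<open>k\<close>-th power sends a constant series to a monomial of degree
  \<open>k\<close>. Only the summand \<open>k = n\<close> reaches degree \<open>n\<close>.\<close>

lemma formal_exp_nth:
  fixes A :: "'x::zero \<Rightarrow> ('m \<Rightarrow> 'v) \<Rightarrow> 'm \<Rightarrow> 'v"
  assumes A: "A e = D" "\<And>y. y \<in> Y \<Longrightarrow> A 0 y = 0" and y: "y \<in> Y"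
  shows "fps_nth (formal_exp (fps_extend2 A (t_times e)) (fps_const y)) n = exp_coeff n y"
proof -
  let ?T = "fps_extend2 A (t_times e)"
  have zero: "0 \<in> Y" using scale_closed[OF y, of 0] by simp
  \<comment> \<open>\<open>t_times e\<close> has its only possibly nonzero coefficient in degree 1,
    whence the shift; the other terms vanish by the assumption on \<open>A 0\<close>.\<close>
  have T: "fps_nth (?T F) i = (if i = 0 then 0 else D (fps_nth F (i - 1)))"
    if F: "\<And>i. fps_nth F i \<in> Y" for F i
  proof -
    have "fps_nth (?T F) i = (\<Sum>j\<le>i. if j = 1 then D (fps_nth F (i - 1)) else 0)"
      unfolding fps_extend2_def fps_nth_Abs_fps
      by (intro sum.cong) (auto simp: t_times_def A F)
    then show ?thesis by auto
  qed
  have pow: "fps_nth ((?T ^^ k) (fps_const y)) i = (if i = k then (D ^^ k) y else 0)" for k i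
  proof (induction k arbitrary: i)
    case (Suc k)
    \<comment> \<open>\<open>T\<close> requires every coefficient to lie in \<open>Y\<close>,
      including the vanishing ones, hence the fact \<open>zero\<close>.\<close>
    have "fps_nth ((?T ^^ k) (fps_const y)) i \<in> Y" for i
      unfolding Suc.IH using zero funpow_closed[OF y] by metis
    then have "fps_nth ((?T ^^ Suc k) (fps_const y)) i =
        (if i = 0 then 0 else D (if i - 1 = k then (D ^^ k) y else 0))"
      using T by (simp only: funpow.simps o_apply Suc.IH)
    then show ?case using operator_zero[OF y] by (cases i) (auto simp: zero_fun_def)
  qed simp
  have "formal_exp ?T (fps_const y) =
      Abs_fps (\<lambda>N. \<Sum>k\<le>N. section_scale (1 / fact k) (fps_nth ((?T ^^ k) (fps_const y)) N))"
    unfolding formal_exp_def by (intro sums_unique[symmetric] formal_exp_sums) (simp add: pow)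
  also have "fps_nth \<dots> n = (\<Sum>k\<le>n. if k = n then exp_coeff n y else 0)"
    unfolding fps_nth_Abs_fps by (intro sum.cong) (auto simp: pow exp_coeff_def)
  finally show ?thesis by simp
qed

end

text \<open>Induction on \<open>n\<close>: apply \<open>D\<^sub>3\<close> to the convolution for
  \<open>n\<close>, collect terms by degree, and divide by \<open>Suc n\<close>. The three operators
  may act on different spaces, so one statement yields both identities.\<close>

lemma exp_coeff_leibniz:
  fixes \<beta> :: "('m \<Rightarrow> 'u::real_vector) \<Rightarrow> ('m \<Rightarrow> 'v::real_vector) \<Rightarrow> 'm \<Rightarrow> 'w::real_vector"
  assumes "section_operator X D\<^sub>1" "section_operator Y D\<^sub>2" "section_operator Z D\<^sub>3"
    and \<beta>_closed: "\<And>x y. x \<in> X \<Longrightarrow> y \<in> Y \<Longrightarrow> \<beta> x y \<in> Z"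
    and \<beta>_left: "\<And>c x y. x \<in> X \<Longrightarrow> y \<in> Y \<Longrightarrow> \<beta> (section_scale c x) y = section_scale c (\<beta> x y)"
    and \<beta>_right: "\<And>c x y. x \<in> X \<Longrightarrow> y \<in> Y \<Longrightarrow> \<beta> x (section_scale c y) = section_scale c (\<beta> x y)"
    and leibniz: "\<And>x y. x \<in> X \<Longrightarrow> y \<in> Y \<Longrightarrow> D\<^sub>3 (\<beta> x y) = \<beta> (D\<^sub>1 x) y + \<beta> x (D\<^sub>2 y)"
    and x: "x \<in> X" and y: "y \<in> Y"
  shows "section_operator.exp_coeff D\<^sub>3 n (\<beta> x y) =
    (\<Sum>i\<le>n. \<beta> (section_operator.exp_coeff D\<^sub>1 i x) (section_operator.exp_coeff D\<^sub>2 (n - i) y))"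
proof -
  interpret X: section_operator X D\<^sub>1 by fact
  interpret Y: section_operator Y D\<^sub>2 by fact
  interpret Z: section_operator Z D\<^sub>3 by fact
  let ?a = "\<lambda>i. X.exp_coeff i x" and ?b = "\<lambda>i. Y.exp_coeff i y"
  have a: "?a i \<in> X" and b: "?b i \<in> Y" for i
    using x y by (auto intro: X.exp_coeff_closed Y.exp_coeff_closed)
  show ?thesis
  proof (induction n)
    case 0
    show ?case by (simp add: X.exp_coeff_0 Y.exp_coeff_0 Z.exp_coeff_0)
  next
    case (Suc n)
    let ?g = "\<lambda>j. \<beta> (?a j) (?b (Suc n - j))"
    \<comment> \<open>Differentiating the left factor raises its index and gives weight
      \<open>Suc i\<close>; differentiating the right one gives weight
      \<open>Suc n - i\<close>.\<close>
    have D: "D\<^sub>3 (\<beta> (?a i) (?b (n - i))) =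
        section_scale (real (Suc i)) (?g (Suc i)) + section_scale (real (Suc n - i)) (?g i)"
      if "i \<le> n" for i
      using that x y
      by (simp add: leibniz a b X.operator_exp_coeff Y.operator_exp_coeff \<beta>_left \<beta>_right
          Suc_diff_le del: of_nat_Suc)
    have "D\<^sub>3 (Z.exp_coeff n (\<beta> x y)) = (\<Sum>i\<le>n. D\<^sub>3 (\<beta> (?a i) (?b (n - i))))"
      unfolding Suc.IH by (rule Z.operator_sum_atMost) (intro \<beta>_closed a b)
    also have "\<dots> = (\<Sum>i\<le>n. section_scale (real (Suc i)) (?g (Suc i)))
        + (\<Sum>i\<le>n. section_scale (real (Suc n - i)) (?g i))"
      unfolding sum.distrib[symmetric] by (intro sum.cong D) auto
    \<comment> \<open>The shifted sum gains a term at \<open>j = 0\<close>, of weight 0.\<close>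
    also have "(\<Sum>i\<le>n. section_scale (real (Suc i)) (?g (Suc i)))
        = (\<Sum>j\<le>Suc n. section_scale (real j) (?g j))"
      unfolding sum.atMost_Suc_shift[of _ n] by simp
    \<comment> \<open>The added term \<open>j = Suc n\<close> also has weight 0.\<close>
    also have "(\<Sum>i\<le>n. section_scale (real (Suc n - i)) (?g i))
        = (\<Sum>j\<le>Suc n. section_scale (real (Suc n - j)) (?g j))"
      by simp
    \<comment> \<open>The weights \<open>j\<close> and \<open>Suc n - j\<close> add up to
      \<open>Suc n\<close>, independently of \<open>j\<close>.\<close>
    also have "(\<Sum>j\<le>Suc n. section_scale (real j) (?g j)) + \<dots>
        = (\<Sum>j\<le>Suc n. section_scale (real (Suc n)) (?g j))"
      unfolding sum.distrib[symmetric] section_scale.scale_left_distrib[symmetric]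
      by (intro sum.cong) auto
    also have "\<dots> = section_scale (real (Suc n)) (\<Sum>j\<le>Suc n. ?g j)"
      by (rule section_scale.scale_sum_right[symmetric])
    finally show ?case
      using Z.exp_coeff_Suc[OF \<beta>_closed[OF x y], of n] by (simp del: of_nat_Suc sum.atMost_Suc)
  qed
qed

section \<open>Vaisman algebroids\<close>

context vaisman_algebroid
begin

lemma section_operator_bracket:
  assumes "e \<in> smooth_sections atlas fib trivs"
  shows "section_operator (smooth_sections atlas fib trivs) (bracket e)"
  using assms by unfold_locales (auto intro: smooth_sections_add smooth_sections_scale bracket_closed
      bracket_add_right bracket_scale_right)

lemma bracket_zero_left:
  assumes "s \<in> smooth_sections atlas fib trivs"
  shows "bracket 0 s = 0"
  using bracket_scale_left[OF assms assms, of 0] by simp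

lemma anchor_tangent:
  "e \<in> smooth_sections atlas fib trivs \<Longrightarrow> \<rho> p (e p) \<in> tangent_space atlas p"
  using anchor_bundle_map smooth_sections_fibre unfolding bundle_map_to_tangent_def by blast

text \<open>Linearity comes from the values of \<rho> being tangent vectors; closure is the
  smoothness of the anchor action.\<close>

lemma section_operator_anchor:
  assumes e: "e \<in> smooth_sections atlas fib trivs"
  shows "section_operator (smooth_functions atlas) (anchor_action \<rho> e)"
proof
  fix f g assume f: "f \<in> smooth_functions atlas" and g: "g \<in> smooth_functions atlas"
  show "anchor_action \<rho> e (f + g) = anchor_action \<rho> e f + anchor_action \<rho> e g"
    using anchor_tangent[OF e] f g
    by (auto simp: fun_eq_iff anchor_action_def tangent_space_def plus_fun_def)
next
  fix f c assume f: "f \<in> smooth_functions atlas"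
  show "anchor_action \<rho> e (section_scale c f) = section_scale c (anchor_action \<rho> e f)"
    using anchor_tangent[OF e] f
    by (auto simp: fun_eq_iff anchor_action_def tangent_space_def section_scale_def)
qed (auto intro: smooth_functions_add smooth_functions_scale
    anchor_action_smooth[OF anchor_bundle_map e])

lemma anchor_zero: "anchor_action \<rho> 0 f = 0"
proof
  fix p
  have "\<rho> p (0 *\<^sub>R 0) f = 0 *\<^sub>R \<rho> p 0 f"
    using anchor_bundle_map subspace_0[OF fibre_subspace[of p]]
    unfolding bundle_map_to_tangent_def linear_between_def by blast
  then show "anchor_action \<rho> 0 f p = 0 p" by (simp add: anchor_action_def)
qed

lemma exp_ad_nth:
  assumes "e \<in> smooth_sections atlas fib trivs" "s \<in> smooth_sections atlas fib trivs"
  shows "fps_nth (exp_ad bracket e s) n = section_operator.exp_coeff (bracket e) n s"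
  unfolding exp_ad_def
  by (rule section_operator.formal_exp_nth[where A = bracket, OF section_operator_bracket[OF assms(1)] refl
        bracket_zero_left assms(2)])

lemma exp_anchor_nth:
  assumes "e \<in> smooth_sections atlas fib trivs" "f \<in> smooth_functions atlas"
  shows "fps_nth (exp_anchor \<rho> e f) n = section_operator.exp_coeff (anchor_action \<rho> e) n f"
  unfolding exp_anchor_def
  by (rule section_operator.formal_exp_nth[where A = "anchor_action \<rho>", OF section_operator_anchor[OF assms(1)] refl
        anchor_zero assms(2)])

text \<open>\<open>ip_linear\<close> speaks of the second argument, so symmetry is used before and
  after scaling.\<close>

lemma section_inner_scale_left:
  assumes s: "s \<in> smooth_sections atlas fib trivs" and t: "t \<in> smooth_sections atlas fib trivs"
  shows "section_inner ip (section_scale c s) t = section_scale c (section_inner ip s t)"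
proof
  fix p
  have v: "s p \<in> fib p" "t p \<in> fib p" "c *\<^sub>R s p \<in> fib p"
    using smooth_sections_fibre[OF s] smooth_sections_fibre[OF t] subspace_scale[OF fibre_subspace]
    by auto
  then have "ip p (t p) (c *\<^sub>R s p) = c *\<^sub>R ip p (t p) (s p)"
    using ip_linear[of "t p" p] unfolding linear_between_def by blast
  then show "section_inner ip (section_scale c s) t p = section_scale c (section_inner ip s t) p"
    using v by (simp add: section_inner_def section_scale_def ip_sym[of "t p"])
qed

lemma section_inner_sym:
  "s \<in> smooth_sections atlas fib trivs \<Longrightarrow> t \<in> smooth_sections atlas fib trivs \<Longrightarrow>
    section_inner ip s t = section_inner ip t s"
  unfolding section_inner_def by (intro ext ip_sym smooth_sections_fibre)

lemma section_inner_scale_right: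
  assumes "s \<in> smooth_sections atlas fib trivs" "t \<in> smooth_sections atlas fib trivs"
  shows "section_inner ip s (section_scale c t) = section_scale c (section_inner ip s t)"
  using assms section_inner_scale_left[OF assms(2,1)]
  by (simp add: section_inner_sym[of s] smooth_sections_scale)

lemma formal_metric_pre_rackoid_exp:
  "formal_metric_pre_rackoid atlas fib trivs ip (exp_ad bracket) (exp_anchor \<rho>)"
proof
  fix e s n
  assume e: "e \<in> smooth_sections atlas fib trivs" and s: "s \<in> smooth_sections atlas fib trivs"
  then show "fps_nth (exp_ad bracket e s) n \<in> smooth_sections atlas fib trivs"
    by (simp add: exp_ad_nth section_operator.exp_coeff_closed[OF section_operator_bracket])
next
  fix e f n
  assume e: "e \<in> smooth_sections atlas fib trivs" and f: "f \<in> smooth_functions atlas"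
  then show "fps_nth (exp_anchor \<rho> e f) n \<in> smooth_functions atlas"
    by (simp add: exp_anchor_nth section_operator.exp_coeff_closed[OF section_operator_anchor])
next
  fix e s f
  assume e: "e \<in> smooth_sections atlas fib trivs" and s: "s \<in> smooth_sections atlas fib trivs"
    and f: "f \<in> smooth_functions atlas"
  show "exp_ad bracket e (fun_times_section f s) =
      fps_extend2 fun_times_section (exp_anchor \<rho> e f) (exp_ad bracket e s)"
  proof (rule fps_ext)
    fix n
    \<comment> \<open>The pairing multiplies functions with sections and lands in sections, so the
      bracket serves as second and third operator; the Leibniz rule is
      \<open>bracket_anchor\<close>.\<close>
    note op = section_operator_anchor[OF e] section_operator_bracket[OF e]
    show "fps_nth (exp_ad bracket e (fun_times_section f s)) n =
        fps_nth (fps_extend2 fun_times_section (exp_anchor \<rho> e f) (exp_ad bracket e s)) n"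
      unfolding fps_extend2_def fps_nth_Abs_fps exp_ad_nth[OF e s] exp_anchor_nth[OF e f]
        exp_ad_nth[OF e smooth_sections_fun_times[OF f s]]
      by (rule exp_coeff_leibniz[OF op op(2)])
        (use e s f in \<open>auto simp: bracket_anchor add.commute smooth_sections_fun_times
          fun_times_section_scale_left fun_times_section_scale_right\<close>)
  qed
next
  fix e s t
  assume e: "e \<in> smooth_sections atlas fib trivs" and s: "s \<in> smooth_sections atlas fib trivs"
    and t: "t \<in> smooth_sections atlas fib trivs"
  show "exp_anchor \<rho> e (section_inner ip s t) =
      fps_extend2 (section_inner ip) (exp_ad bracket e s) (exp_ad bracket e t)"
  proof (rule fps_ext)
    fix n
    \<comment> \<open>Here both arguments are sections and the values are functions: the bracket
      acts twice, the anchor on the result, and the Leibniz rule is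
      \<open>bracket_inner\<close>.\<close>
    note op = section_operator_bracket[OF e]
    show "fps_nth (exp_anchor \<rho> e (section_inner ip s t)) n =
        fps_nth (fps_extend2 (section_inner ip) (exp_ad bracket e s) (exp_ad bracket e t)) n"
      unfolding fps_extend2_def fps_nth_Abs_fps exp_ad_nth[OF e s] exp_ad_nth[OF e t]
        exp_anchor_nth[OF e section_inner_smooth[OF s t]]
      by (rule exp_coeff_leibniz[where \<beta> = "section_inner ip",
            OF op op section_operator_anchor[OF e]])
        (simp_all add: e s t section_inner_smooth section_inner_scale_left
          section_inner_scale_right bracket_inner)
  qed
qed

end

theorem mainTheorem3:
  fixes atlas :: "('m::{t2_space,second_countable_topology}, 'a::real_inner) chart set"
    and fib :: "'m \<Rightarrow> 'v::real_vector set"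
    and trivs :: "('m, 'v, 'f::real_inner) triv set"
    and ip :: "'m \<Rightarrow> 'v \<Rightarrow> 'v \<Rightarrow> real"
    and bracket :: "('m \<Rightarrow> 'v) \<Rightarrow> ('m \<Rightarrow> 'v) \<Rightarrow> 'm \<Rightarrow> 'v"
    and \<rho> :: "'m \<Rightarrow> 'v \<Rightarrow> ('m \<Rightarrow> real) \<Rightarrow> real"
  assumes "vaisman_algebroid atlas fib trivs ip bracket \<rho>"
  shows "formal_metric_pre_rackoid atlas fib trivs ip (exp_ad bracket) (exp_anchor \<rho>)"
  using assms by (rule vaisman_algebroid.formal_metric_pre_rackoid_exp)

end
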